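(* Let $n\ge1$ and let $\widehat{A}^{(n)}=\widehat{B}^{(n-1)}+\epsilon_{n} \widehat{C}^{(n-1)}$ be a (square) $n$-order dual matrix such that $(\widehat{B}^{(n-1)})^{\#}$ exists. Then $\widehat{A}^{(n)}$ has a group inverse if and only if $$\left[I-\widehat{B}^{(n-1)}(\widehat{B}^{(n-1)})^{\#}\right]\widehat{C}^{(n-1)}\left[I-\widehat{B}^{(n-1)}(\widehat{B}^{(n-1)})^{\#}\right]=0.$$ Moreover, if the group inverse of $\widehat{A}^{(n)}$ exists, then $$(\widehat{A}^{(n)})^\#=(\widehat{B}^{(n-1)})^\#+\epsilon_{n}\widehat{Z}^{(n-1)},$$ where $$\begin{aligned}\widehat{Z}^{(n-1)}&=-(\widehat{B}^{(n-1)})^{\#}\widehat{C}^{(n-1)}(\widehat{B}^{(n-1)})^\#+((\widehat{B}^{(n-1)})^{\#})^{2}\widehat{C}^{(n-1)}(I-\widehat{B}^{(n-1)}(\widehat{B}^{(n-1)})^{\#})\\&\quad+(I-\widehat{B}^{(n-1)}(\widehat{B}^{(n-1)})^{\#})\widehat{C}^{(n-1)}((\widehat{B}^{(n-1)})^{\#})^{2}.\end{aligned}$$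
   Context: Let $\epsilon_1,\epsilon_2,\dots$ be commuting dual units with $\epsilon_i^2=0$ and nonzero products of distinct units. All matrices are square of one fixed size. A $0$-order dual matrix is a real matrix; recursively, an $n$-order dual matrix is $\widehat{A}^{(n)}=\widehat{B}^{(n-1)}+\epsilon_{n} \widehat{C}^{(n-1)}$ with $\widehat{B}^{(n-1)},\widehat{C}^{(n-1)}$ dual matrices of $(n-1)$-order (so its entries lie in $\mathbb{R}[\epsilon_1,\dots,\epsilon_n]/(\epsilon_1^2,\dots,\epsilon_n^2)$, and $\widehat B^{(n-1)},\widehat C^{(n-1)}$ are uniquely determined). A group inverse of a dual matrix $M$ of some order is a dual matrix $G=M^{\#}$ of the same order with $MGM=M$, $GMG=G$, $MG=GM$. *)

theory Defs
  imports "HOL-Analysis.Analysis"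
begin

section \<open>The ring of higher-order dual numbers\<close>

text \<open>
  The type \<open>dual\<close> is the ring of real polynomials in the commuting units \<open>eps 0, eps 1, \<dots>\<close> modulo
  the squares of the units, i.e. the union over n of the n-order rings. An element is represented
  by its coordinates in the basis of squarefree monomials: the value at \<open>S\<close> is the coefficient of
  the product of the units \<open>eps i\<close>, \<open>i \<in> S\<close>. Each element involves finitely many units.
\<close>

typedef dual = "{f :: nat set \<Rightarrow> real. \<exists>n. \<forall>S. \<not> S \<subseteq> {..n} \<longrightarrow> f S = 0}"
  morphisms dcoeff Abs_dual
  by (rule exI[of _ "\<lambda>_. 0"]) simp

setup_lifting type_definition_dual

lemma dual_eqI: "(\<And>S. dcoeff x S = dcoeff y S) \<Longrightarrow> x = y"
  by (metis dcoeff_inject ext)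

lemma dcoeff_infinite: "infinite S \<Longrightarrow> dcoeff x S = 0"
  by transfer (meson finite_atMost finite_subset)

lemma dual_bound2:
  fixes f g :: "nat set \<Rightarrow> real"
  assumes "\<exists>n. \<forall>S. \<not> S \<subseteq> {..n} \<longrightarrow> f S = 0" "\<exists>n. \<forall>S. \<not> S \<subseteq> {..n} \<longrightarrow> g S = 0"
  shows "\<exists>n. \<forall>S. \<not> S \<subseteq> {..n} \<longrightarrow> f S = 0 \<and> g S = 0"
proof -
  from assms obtain m k where *: "\<forall>S. \<not> S \<subseteq> {..m} \<longrightarrow> f S = 0" "\<forall>S. \<not> S \<subseteq> {..k} \<longrightarrow> g S = 0"
    by blast
  have "{..m} \<subseteq> {..max m k}" "{..k} \<subseteq> {..max m k}" by auto
  with * show ?thesis by (meson order_trans)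
qed

instantiation dual :: comm_ring_1
begin

lift_definition zero_dual :: dual is "\<lambda>_. 0" by simp

lift_definition one_dual :: dual is "\<lambda>S. if S = {} then 1 else 0" by auto

lift_definition plus_dual :: "dual \<Rightarrow> dual \<Rightarrow> dual" is "\<lambda>f g S. f S + g S"
  by (drule (1) dual_bound2) (metis add_0)

lift_definition minus_dual :: "dual \<Rightarrow> dual \<Rightarrow> dual" is "\<lambda>f g S. f S - g S"
  by (drule (1) dual_bound2) (metis diff_self)

lift_definition uminus_dual :: "dual \<Rightarrow> dual" is "\<lambda>f S. - f S" by simp

text \<open>
  The monomials of \<open>T\<close> and \<open>U\<close> multiply to that of \<open>T \<union> U\<close> if \<open>T\<close>, \<open>U\<close> are disjoint, and to 0
  otherwise (some unit then occurs squared).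
\<close>

lift_definition times_dual :: "dual \<Rightarrow> dual \<Rightarrow> dual" is
  "\<lambda>f g S. \<Sum>T\<in>Pow S. f T * g (S - T)"
proof -
  fix f g :: "nat set \<Rightarrow> real"
  assume "\<exists>n. \<forall>S. \<not> S \<subseteq> {..n} \<longrightarrow> f S = 0" "\<exists>n. \<forall>S. \<not> S \<subseteq> {..n} \<longrightarrow> g S = 0"
  then have "\<exists>n. \<forall>S. \<not> S \<subseteq> {..n} \<longrightarrow> f S = 0 \<and> g S = 0" by (rule dual_bound2)
  then obtain n where n: "\<forall>S. \<not> S \<subseteq> {..n} \<longrightarrow> f S = 0 \<and> g S = 0" ..
  have "(\<Sum>T\<in>Pow S. f T * g (S - T)) = 0" if "\<not> S \<subseteq> {..n}" for S
  proof (rule sum.neutral, intro ballI)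
    fix T assume "T \<in> Pow S"
    with that have "\<not> T \<subseteq> {..n} \<or> \<not> S - T \<subseteq> {..n}" by blast
    then show "f T * g (S - T) = 0" using n mult_zero_left mult_zero_right by metis
  qed
  then show "\<exists>n. \<forall>S. \<not> S \<subseteq> {..n} \<longrightarrow> (\<Sum>T\<in>Pow S. f T * g (S - T)) = 0" by blast
qed

instance
proof
  fix a b c :: dual
  show "a * b * c = a * (b * c)"
  proof (rule dual_eqI)
    fix S
    show "dcoeff (a * b * c) S = dcoeff (a * (b * c)) S"
    proof (cases "finite S")
      case True
      have fin: "finite T" if "T \<subseteq> S" for T using True that by (rule rev_finite_subset)
      have "dcoeff (a * b * c) S =
          (\<Sum>T\<in>Pow S. \<Sum>U\<in>Pow T. dcoeff a U * dcoeff b (T - U) * dcoeff c (S - T))"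
        by (simp add: times_dual.rep_eq sum_distrib_right)
      also have "\<dots> = (\<Sum>(T, U)\<in>(SIGMA T:Pow S. Pow T).
          dcoeff a U * dcoeff b (T - U) * dcoeff c (S - T))"
        using True fin by (subst sum.Sigma) auto
      also have "\<dots> = (\<Sum>(U, V)\<in>(SIGMA U:Pow S. Pow (S - U)).
          dcoeff a U * (dcoeff b V * dcoeff c (S - U - V)))"
        by (rule sum.reindex_bij_witness[of _ "\<lambda>(U, V). (U \<union> V, U)" "\<lambda>(T, U). (U, T - U)"])
          (auto simp: mult.assoc intro!: arg_cong[of _ _ "dcoeff _"])
      also have "\<dots> = (\<Sum>U\<in>Pow S. \<Sum>V\<in>Pow (S - U).
          dcoeff a U * (dcoeff b V * dcoeff c (S - U - V)))"
        using True by (subst sum.Sigma) auto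
      also have "\<dots> = dcoeff (a * (b * c)) S"
        by (simp add: times_dual.rep_eq sum_distrib_left)
      finally show ?thesis .
    qed (simp add: dcoeff_infinite)
  qed
  show "a * b = b * a"
  proof (rule dual_eqI)
    fix S
    show "dcoeff (a * b) S = dcoeff (b * a) S"
      unfolding times_dual.rep_eq
      by (rule sum.reindex_bij_witness[of _ "\<lambda>T. S - T" "\<lambda>T. S - T"])
        (auto simp: double_diff mult.commute)
  qed
  show "1 * a = a"
  proof (rule dual_eqI)
    fix S
    show "dcoeff (1 * a) S = dcoeff a S"
    proof (cases "finite S")
      case True
      have "dcoeff (1 * a) S = (\<Sum>T\<in>Pow S. if T = {} then dcoeff a S else 0)"
        unfolding times_dual.rep_eq one_dual.rep_eq by (rule sum.cong) auto
      with True show ?thesis by simp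
    qed (simp add: dcoeff_infinite)
  qed
  show "(a + b) * c = a * c + b * c"
    by transfer (simp add: sum.distrib distrib_right)
  show "a + b + c = a + (b + c)" by transfer (simp add: add.assoc)
  show "a + b = b + a" by transfer (simp add: add.commute)
  show "0 + a = a" by transfer simp
  show "- a + a = 0" by transfer simp
  show "a - b = a + - b" by transfer simp
  show "(0 :: dual) \<noteq> 1" by transfer (metis zero_neq_one)
qed

end

instantiation dual :: real_algebra_1
begin

lift_definition scaleR_dual :: "real \<Rightarrow> dual \<Rightarrow> dual" is "\<lambda>r f S. r * f S" by auto

instance
  by standard (transfer; simp add: algebra_simps sum_distrib_left)+

end

lift_definition eps :: "nat \<Rightarrow> dual" is "\<lambda>i S. if S = {i} then 1 else 0"
  by (rule_tac x = nat in exI) auto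

lemma dcoeff_eps_mult:
  "dcoeff (eps i * x) S = (if i \<in> S then dcoeff x (S - {i}) else 0)"
proof (cases "finite S")
  case True
  have "dcoeff (eps i * x) S = (\<Sum>T\<in>Pow S. if T = {i} then dcoeff x (S - {i}) else 0)"
    unfolding times_dual.rep_eq eps.rep_eq by (rule sum.cong) auto
  with True show ?thesis by (simp add: sum.delta)
qed (simp add: dcoeff_infinite)

lemma eps_mult_self: "eps i * eps i = 0"
  by (rule dual_eqI) (auto simp: dcoeff_eps_mult eps.rep_eq zero_dual.rep_eq)

lemma dcoeff_prod_eps:
  "finite S \<Longrightarrow> dcoeff (\<Prod>i\<in>S. eps i) T = (if T = S then 1 else 0)"
proof (induction S arbitrary: T rule: finite_induct)
  case empty
  then show ?case by (simp add: one_dual.rep_eq)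
next
  case (insert i S)
  then show ?case by (auto simp: dcoeff_eps_mult)
qed

lemma prod_eps_nonzero: "finite S \<Longrightarrow> (\<Prod>i\<in>S. eps i) \<noteq> 0"
  by (metis dcoeff_prod_eps zero_dual.rep_eq zero_neq_one)

lemma dcoeff_of_real: "dcoeff (of_real r) S = (if S = {} then r else 0)"
  by (simp add: of_real_def scaleR_dual.rep_eq one_dual.rep_eq)


section \<open>Dual matrices\<close>

definition dsmult :: "dual \<Rightarrow> dual^'m^'m \<Rightarrow> dual^'m^'m"  (infixr "*\<^sub>D" 75)
  where "c *\<^sub>D A = map_matrix ((*) c) A"

text \<open>The unit \<open>eps 0\<close> never occurs below: the n-order dual matrices use \<open>eps 1, \<dots>, eps n\<close>.\<close>

primrec dual_matrix :: "nat \<Rightarrow> dual^'m^'m \<Rightarrow> bool" where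
  "dual_matrix 0 A \<longleftrightarrow> (\<exists>R :: real^'m^'m. A = map_matrix of_real R)"
| "dual_matrix (Suc n) A \<longleftrightarrow>
     (\<exists>B C. dual_matrix n B \<and> dual_matrix n C \<and> A = B + eps (Suc n) *\<^sub>D C)"

lemma dual_matrix_iff_dcoeff:
  "dual_matrix n A \<longleftrightarrow> (\<forall>i j S. \<not> S \<subseteq> {1..n} \<longrightarrow> dcoeff (A $ i $ j) S = 0)"
proof (induction n arbitrary: A)
  case 0
  show ?case
  proof
    assume "dual_matrix 0 A"
    then show "\<forall>i j S. \<not> S \<subseteq> {1..0} \<longrightarrow> dcoeff (A $ i $ j) S = 0"
      by (auto simp: dcoeff_of_real split: if_splits)
  next
    assume *: "\<forall>i j S. \<not> S \<subseteq> {1..0} \<longrightarrow> dcoeff (A $ i $ j) S = 0"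
    have "A $ i $ j = of_real (dcoeff (A $ i $ j) {})" for i j
      by (rule dual_eqI) (use * in \<open>auto simp: dcoeff_of_real\<close>)
    then have "A = map_matrix of_real (map_matrix (\<lambda>x. dcoeff x {}) A)"
      unfolding vec_eq_iff nth_map_matrix by blast
    then show "dual_matrix 0 A" unfolding dual_matrix.simps by blast
  qed
next
  case (Suc n)
  show ?case
  proof
    assume "dual_matrix (Suc n) A"
    then obtain B C where BC: "dual_matrix n B" "dual_matrix n C" "A = B + eps (Suc n) *\<^sub>D C"
      by auto
    show "\<forall>i j S. \<not> S \<subseteq> {1..Suc n} \<longrightarrow> dcoeff (A $ i $ j) S = 0"
    proof (intro allI impI)
      fix i j S assume S: "\<not> S \<subseteq> {1..Suc n}"
      then have "\<not> S \<subseteq> {1..n}" "\<not> S - {Suc n} \<subseteq> {1..n}"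
        by (auto simp: subset_iff le_Suc_eq)
      with BC Suc show "dcoeff (A $ i $ j) S = 0"
        by (simp add: dsmult_def plus_dual.rep_eq dcoeff_eps_mult)
    qed
  next
    assume A: "\<forall>i j S. \<not> S \<subseteq> {1..Suc n} \<longrightarrow> dcoeff (A $ i $ j) S = 0"
    define b where "b x = Abs_dual (\<lambda>S. if Suc n \<in> S then 0 else dcoeff x S)" for x
    define c where "c x = Abs_dual (\<lambda>S. if Suc n \<in> S then 0 else dcoeff x (insert (Suc n) S))" for x
    have b: "dcoeff (b x) S = (if Suc n \<in> S then 0 else dcoeff x S)" for x S
      using dcoeff[of x] unfolding b_def by (subst Abs_dual_inverse) auto
    have c: "dcoeff (c x) S = (if Suc n \<in> S then 0 else dcoeff x (insert (Suc n) S))" for x S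
      using dcoeff[of x] unfolding c_def
      by (subst Abs_dual_inverse) (auto, meson insert_subset)
    have "dual_matrix n (\<chi> i j. b (A $ i $ j))"
    proof -
      have "S \<subseteq> {1..n}" if "S \<subseteq> {1..Suc n}" "Suc n \<notin> S" for S
        using that by (auto simp: subset_iff le_Suc_eq)
      with A show ?thesis unfolding Suc b vec_lambda_beta by meson
    qed
    moreover have "dual_matrix n (\<chi> i j. c (A $ i $ j))"
    proof -
      have "S \<subseteq> {1..n}" if "insert (Suc n) S \<subseteq> {1..Suc n}" "Suc n \<notin> S" for S
        using that by (auto simp: subset_iff le_Suc_eq)
      with A show ?thesis unfolding Suc c vec_lambda_beta by meson
    qed
    moreover have "A = (\<chi> i j. b (A $ i $ j)) + eps (Suc n) *\<^sub>D (\<chi> i j. c (A $ i $ j))"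
    proof -
      have "x = b x + eps (Suc n) * c x" for x
        by (rule dual_eqI) (auto simp: plus_dual.rep_eq dcoeff_eps_mult b c insert_absorb)
      then show ?thesis by (simp add: dsmult_def vec_eq_iff)
    qed
    ultimately show "dual_matrix (Suc n) A" unfolding dual_matrix.simps by blast
  qed
qed

lemma dual_matrix_decomp_unique:
  assumes "dual_matrix n B" "dual_matrix n C" "dual_matrix n B'" "dual_matrix n C'"
    and eq: "B + eps (Suc n) *\<^sub>D C = B' + eps (Suc n) *\<^sub>D C'"
  shows "B = B' \<and> C = C'"
proof -
  have z: "dcoeff (X $ i $ j) S = 0" if "dual_matrix n X" "Suc n \<in> S" for X :: "dual^'a^'a" and i j S
    using that unfolding dual_matrix_iff_dcoeff by (meson Suc_n_not_le_n atLeastAtMost_iff subsetD)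
  have e: "dcoeff (B $ i $ j) S + dcoeff (eps (Suc n) * C $ i $ j) S =
        dcoeff (B' $ i $ j) S + dcoeff (eps (Suc n) * C' $ i $ j) S" for i j S
    using arg_cong[OF eq, of "\<lambda>X. dcoeff (X $ i $ j) S"] by (simp add: dsmult_def plus_dual.rep_eq)
  have "dcoeff (B $ i $ j) S = dcoeff (B' $ i $ j) S" for i j S
    using e[of i j S] z[OF assms(1), of S i j] z[OF assms(3), of S i j]
    by (cases "Suc n \<in> S") (simp_all add: dcoeff_eps_mult)
  moreover have "dcoeff (C $ i $ j) S = dcoeff (C' $ i $ j) S" for i j S
    using e[of i j "insert (Suc n) S"] assms(1-4)[THEN z, of S i j]
      z[OF assms(1), of "insert (Suc n) S" i j] z[OF assms(3), of "insert (Suc n) S" i j]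
    by (cases "Suc n \<in> S") (simp_all add: dcoeff_eps_mult)
  ultimately show ?thesis by (simp add: vec_eq_iff dual_eqI)
qed


section \<open>Group inverses\<close>

definition is_group_inverse :: "nat \<Rightarrow> dual^'m^'m \<Rightarrow> dual^'m^'m \<Rightarrow> bool" where
  "is_group_inverse n M G \<longleftrightarrow>
     dual_matrix n G \<and> M ** G ** M = M \<and> G ** M ** G = G \<and> M ** G = G ** M"

definition has_group_inverse :: "nat \<Rightarrow> dual^'m^'m \<Rightarrow> bool" where
  "has_group_inverse n M \<longleftrightarrow> (\<exists>G. is_group_inverse n M G)"

definition group_inverse :: "nat \<Rightarrow> dual^'m^'m \<Rightarrow> dual^'m^'m" where
  "group_inverse n M = (THE G. is_group_inverse n M G)"

lemma is_group_inverse_unique: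
  assumes "is_group_inverse n M G" "is_group_inverse n M H"
  shows "G = H"
proof -
  have G: "M ** G ** M = M" "G ** M ** G = G" "M ** G = G ** M"
    and H: "M ** H ** M = M" "H ** M ** H = H" "M ** H = H ** M"
    using assms by (auto simp: is_group_inverse_def)
  have GM: "G ** M = H ** M"
  proof -
    have "G ** M = G ** (M ** H ** M)" by (simp only: H(1))
    also have "\<dots> = (G ** M) ** (H ** M)" by (simp only: matrix_mul_assoc)
    also have "\<dots> = (M ** G) ** (M ** H)" by (simp only: G(3) H(3))
    also have "\<dots> = (M ** G ** M) ** H" by (simp only: matrix_mul_assoc)
    also have "\<dots> = H ** M" by (simp only: G(1) H(3))
    finally show ?thesis .
  qed
  have "G = (G ** M) ** G" by (simp only: G(2))
  also have "\<dots> = H ** (M ** G)" by (simp only: GM matrix_mul_assoc)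
  also have "\<dots> = H ** (M ** H)" by (simp only: G(3) GM H(3))
  also have "\<dots> = H" by (simp only: H(2) matrix_mul_assoc)
  finally show ?thesis .
qed

lemma group_inverse_eqI: "is_group_inverse n M G \<Longrightarrow> group_inverse n M = G"
  unfolding group_inverse_def by (blast intro: is_group_inverse_unique)

lemma is_group_inverse_group_inverse:
  "has_group_inverse n M \<Longrightarrow> is_group_inverse n M (group_inverse n M)"
  by (metis group_inverse_eqI has_group_inverse_def)

end

theory Submission
  imports Defs
begin

text \<open>
  Comparing coefficients of \<open>\<epsilon>\<^sub>n\<close> in \<open>A X A = A\<close> expresses \<open>C\<close> as a sum of terms with a left or right
  factor \<open>B\<close>, and the projection \<open>P = I - B B\<^sup>#\<close> annihilates \<open>B\<close> on both sides, so \<open>P C P = 0\<close>.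
  Conversely, if \<open>P C P = 0\<close> then \<open>A\<close> and \<open>B\<^sup># + \<epsilon>\<^sub>n Z\<close> commute, both products being
  \<open>B B\<^sup># + \<epsilon>\<^sub>n (P C B\<^sup># + B\<^sup># C P)\<close>, and the other two equations follow from this form.
\<close>

lemma dcoeff_sum: "dcoeff (sum f I) S = (\<Sum>i\<in>I. dcoeff (f i) S)"
  by (induction I rule: infinite_finite_induct) (simp_all add: zero_dual.rep_eq plus_dual.rep_eq)

lemma dual_matrix_mat_1: "dual_matrix n (mat 1)"
  by (auto simp: dual_matrix_iff_dcoeff mat_def one_dual.rep_eq zero_dual.rep_eq)

lemma dual_matrix_add: "dual_matrix n A \<Longrightarrow> dual_matrix n B \<Longrightarrow> dual_matrix n (A + B)"
  by (simp add: dual_matrix_iff_dcoeff plus_dual.rep_eq)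

lemma dual_matrix_uminus: "dual_matrix n A \<Longrightarrow> dual_matrix n (- A)"
  by (simp add: dual_matrix_iff_dcoeff uminus_dual.rep_eq)

lemma dual_matrix_diff: "dual_matrix n A \<Longrightarrow> dual_matrix n B \<Longrightarrow> dual_matrix n (A - B)"
  by (simp add: dual_matrix_iff_dcoeff minus_dual.rep_eq)

text \<open>If the monomial of \<open>S\<close> involves a unit outside
  \<open>eps 1, ..., eps n\<close>, then in each splitting into \<open>T\<close> and
  \<open>S - T\<close> one part contains that unit and has coefficient 0.\<close>

lemma dual_matrix_mult:
  assumes "dual_matrix n A" "dual_matrix n B"
  shows "dual_matrix n (A ** B)"
  unfolding dual_matrix_iff_dcoeff
proof (intro allI impI)
  fix i j S assume S: "\<not> S \<subseteq> {1..n}"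
  have "dcoeff (A $ i $ k) T * dcoeff (B $ k $ j) (S - T) = 0" for k T
  proof -
    from S have "\<not> T \<subseteq> {1..n} \<or> \<not> S - T \<subseteq> {1..n}" by blast
    with assms show ?thesis unfolding dual_matrix_iff_dcoeff by (metis mult_eq_0_iff)
  qed
  then show "dcoeff ((A ** B) $ i $ j) S = 0"
    by (simp add: matrix_matrix_mult_def dcoeff_sum times_dual.rep_eq sum.neutral)
qed

lemmas dual_matrix_intros =
  dual_matrix_mat_1 dual_matrix_add dual_matrix_uminus dual_matrix_diff dual_matrix_mult

lemma matrix_minus_mult_left: "(- A) ** B = - (A ** B)" for A :: "'a::ring_1^'m^'k"
  by (simp add: matrix_matrix_mult_def vec_eq_iff sum_negf)

lemma matrix_minus_mult_right: "A ** (- B) = - (A ** B)" for A :: "'a::ring_1^'m^'k"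
  by (simp add: matrix_matrix_mult_def vec_eq_iff sum_negf)

lemma matrix_diff_ldistrib: "A ** (B - C) = A ** B - A ** C" for A :: "'a::ring_1^'m^'k"
  by (simp add: matrix_matrix_mult_def vec_eq_iff right_diff_distrib sum_subtractf)

lemma matrix_diff_rdistrib: "(A - B) ** C = A ** C - B ** C" for A :: "'a::ring_1^'m^'k"
  by (simp add: matrix_matrix_mult_def vec_eq_iff left_diff_distrib sum_subtractf)

lemma matrix_plus_rdistrib: "(A + B) ** C = A ** C + B ** C" for A :: "'a::ring_1^'m^'k"
  by (simp add: matrix_matrix_mult_def vec_eq_iff distrib_right sum.distrib)

lemmas matrix_ring_simps =
  matrix_minus_mult_left matrix_minus_mult_right matrix_diff_ldistrib matrix_diff_rdistrib
  matrix_add_ldistrib matrix_plus_rdistrib matrix_mul_assoc[symmetric]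

text \<open>The term \<open>C ** E\<close> would carry the square of \<open>eps i\<close>, which is
  0.\<close>

lemma dual_matrix_product:
  "(B + eps i *\<^sub>D C) ** (D + eps i *\<^sub>D E) = B ** D + eps i *\<^sub>D (B ** E + C ** D)"
proof -
  have "(x + eps i * y) * (z + eps i * w) = x * z + eps i * (x * w + y * z)" for x y z w
    by (simp add: algebra_simps eps_mult_self)
  then show ?thesis
    by (simp add: dsmult_def matrix_matrix_mult_def vec_eq_iff sum_distrib_left
        flip: sum.distrib)
qed

text \<open>These are the \<open>eps\<close> coefficients of the group inverse equations for
  \<open>A = B + eps C\<close> and \<open>X = G + eps Z\<close>: the first two give
  \<open>A X = X A\<close>, the third \<open>A X A = A\<close>, the fourth
  \<open>X A X = X\<close>.\<close>

lemma group_inverse_perturbation: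
  fixes B C G P Z :: "'a::ring_1^'m^'m"
  assumes G: "B ** G ** B = B" "G ** B ** G = G" "B ** G = G ** B"
    and P: "P = mat 1 - B ** G" and PCP: "P ** C ** P = 0"
    and Z: "Z = - (G ** C ** G) + G ** G ** C ** P + P ** C ** (G ** G)"
  shows "B ** Z + C ** G = P ** C ** G + G ** C ** P"
    and "G ** C + Z ** B = P ** C ** G + G ** C ** P"
    and "B ** G ** C + (P ** C ** G + G ** C ** P) ** B = C"
    and "G ** B ** Z + (P ** C ** G + G ** C ** P) ** G = Z"
proof -
  have BGG: "B ** (G ** G) = G" and GGB: "G ** (G ** B) = G" and BBG: "B ** (B ** G) = B"
    using G by (metis matrix_mul_assoc)+
  have BP: "B ** P = 0" and PB: "P ** B = 0" and GP: "G ** P = 0" and PG: "P ** G = 0"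
    using G(1,2) BGG BBG
    by (simp_all add: P matrix_diff_ldistrib matrix_diff_rdistrib matrix_mul_assoc)
  \<comment> \<open>Simplification brackets products to the right, where a rule for two factors
    matches only at the end; these variants act further left.\<close>
  have cancel: "B ** (G ** (G ** X)) = G ** X" "B ** (P ** X) = 0" "G ** (P ** X) = 0"
    "P ** (B ** X) = 0" "P ** (G ** X) = 0" for X :: "'a^'m^'m"
    using BGG BP GP PB PG by (simp_all add: matrix_mul_assoc)
  have BG: "B ** (G ** X) = X - P ** X" for X :: "'a^'m^'m"
    by (simp add: P matrix_diff_rdistrib matrix_mul_assoc)
  have BG1: "G ** B = mat 1 - P" by (simp add: P G(3))
  have PCP': "P ** (C ** P) = 0" using PCP by (simp add: matrix_mul_assoc)
  note s = matrix_ring_simps BGG GGB BP PB GP PG cancel PCP'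
  show "B ** Z + C ** G = P ** C ** G + G ** C ** P"
    by (simp add: Z s BG)
  show "G ** C + Z ** B = P ** C ** G + G ** C ** P"
    by (simp add: Z s BG1)
  \<comment> \<open>As \<open>B G = G B = I - P\<close> and \<open>P B = 0\<close>, the left-hand
    side is \<open>C - P C P\<close>; this is where \<open>PCP\<close> enters.\<close>
  show "B ** G ** C + (P ** C ** G + G ** C ** P) ** B = C"
    by (simp add: s BG BG1)
  \<comment> \<open>Since \<open>G B = I - P\<close>, it suffices that \<open>P Z = P C G G\<close>:
    the first two terms of \<open>Z\<close> begin with \<open>G\<close>, and \<open>P G = 0\<close>,
    \<open>P P = P\<close>.\<close>
  have "G ** B ** Z = Z - P ** C ** (G ** G)"
  proof -
    have PP: "P ** (P ** X) = P ** X" for X :: "'a^'m^'m"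
      using BG[of "P ** X"] by (simp add: cancel)
    show ?thesis unfolding BG1 by (simp add: Z s PP)
  qed
  then show "G ** B ** Z + (P ** C ** G + G ** C ** P) ** G = Z"
    by (simp add: s)
qed

theorem theorem6p1:
  fixes n :: nat and A B C :: "dual^'m^'m"
  assumes "n \<ge> 1"
    and "dual_matrix (n - 1) B" and "dual_matrix (n - 1) C"
    and "A = B + eps n *\<^sub>D C"
    and "has_group_inverse (n - 1) B"
  shows "(has_group_inverse n A \<longleftrightarrow>
            (mat 1 - B ** group_inverse (n - 1) B) ** C ** (mat 1 - B ** group_inverse (n - 1) B) = 0)
       \<and> (has_group_inverse n A \<longrightarrow>
            (let G = group_inverse (n - 1) B;
                 Z = - (G ** C ** G) + G ** G ** C ** (mat 1 - B ** G) + (mat 1 - B ** G) ** C ** (G ** G)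
             in group_inverse n A = G + eps n *\<^sub>D Z))"
proof -
  from \<open>n \<ge> 1\<close> obtain k where n: "n = Suc k" by (cases n) auto
  have B: "dual_matrix k B" and C: "dual_matrix k C" and A: "A = B + eps (Suc k) *\<^sub>D C"
    using assms(2-4) n by simp_all
  define G where "G = group_inverse k B"
  define P where "P = mat 1 - B ** G"
  define Z where "Z = - (G ** C ** G) + G ** G ** C ** P + P ** C ** (G ** G)"
  have "is_group_inverse k B G"
    using assms(5) n by (simp add: G_def is_group_inverse_group_inverse)
  then have dG: "dual_matrix k G"
    and G: "B ** G ** B = B" "G ** B ** G = G" "B ** G = G ** B"
    by (auto simp: is_group_inverse_def)
  have necessary: "P ** C ** P = 0" if has: "has_group_inverse n A"
  proof -
    from has obtain H where "is_group_inverse (Suc k) A H"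
      by (auto simp: has_group_inverse_def n)
    then have "dual_matrix (Suc k) H" and AHA: "A ** H ** A = A"
      by (auto simp: is_group_inverse_def)
    then obtain X Y where X: "dual_matrix k X" and Y: "dual_matrix k Y"
      and H: "H = X + eps (Suc k) *\<^sub>D Y" by auto
    have "B ** X ** B + eps (Suc k) *\<^sub>D (B ** X ** C + (B ** Y + C ** X) ** B)
        = B + eps (Suc k) *\<^sub>D C"
      using AHA by (simp add: A H dual_matrix_product)
    \<comment> \<open>Coefficients may be compared because both sides have coefficients of order
      \<open>k\<close>, by closure under sums and products.\<close>
    then have C_eq: "C = B ** X ** C + (B ** Y + C ** X) ** B"
      using dual_matrix_decomp_unique[OF _ _ B C] B C X Y by (metis dual_matrix_add dual_matrix_mult)
    have "B ** P = 0" and PB: "P ** B = 0"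
      using G by (simp_all add: P_def matrix_diff_ldistrib matrix_diff_rdistrib matrix_mul_assoc)
    moreover have "P ** (B ** M) = 0" for M :: "dual^'m^'m"
      by (simp add: matrix_mul_assoc PB)
    \<comment> \<open>\<open>C\<close> recurs on the right of \<open>C_eq\<close>, so it is replaced
      just once; each resulting summand starts or ends with \<open>B\<close>.\<close>
    ultimately show ?thesis
      by (subst C_eq) (simp add: matrix_ring_simps)
  qed
  have sufficient: "is_group_inverse n A (G + eps n *\<^sub>D Z)" if PCP: "P ** C ** P = 0"
  proof -
    note eqs = group_inverse_perturbation[OF G P_def PCP Z_def]
    have "dual_matrix k Z"
      unfolding Z_def P_def by (intro dual_matrix_intros B C dG)
    with dG have "dual_matrix n (G + eps n *\<^sub>D Z)" by (auto simp: n)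
    moreover have "A ** (G + eps n *\<^sub>D Z) = B ** G + eps n *\<^sub>D (P ** C ** G + G ** C ** P)"
      by (simp add: A n dual_matrix_product eqs(1))
    moreover have "(G + eps n *\<^sub>D Z) ** A = B ** G + eps n *\<^sub>D (P ** C ** G + G ** C ** P)"
      by (simp add: A n dual_matrix_product eqs(2) G(3))
    \<comment> \<open>First \<open>A X\<close> and \<open>X A\<close> become their common value;
      only then is the remaining factor \<open>A\<close> expanded.\<close>
    ultimately show ?thesis
      using eqs(3,4) G
      by (simp add: is_group_inverse_def) (simp add: A n dual_matrix_product)
  qed
  \<comment> \<open>For the formula, existence gives \<open>P C P = 0\<close>, hence an explicit
    group inverse, which by uniqueness is \<open>group_inverse n A\<close>.\<close>
  show ?thesis
    using necessary sufficient group_inverse_eqI[OF sufficient]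
    by (auto simp: n Let_def has_group_inverse_def simp flip: G_def P_def) (simp_all add: Z_def)
qed

end
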